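(* Let $(X,\mathcal{B})$ be a bornological universe. The following statements are equivalent: (1) $\mathcal{C}_{\mathcal{B}}(X)$ is an initial source; (2) $(X,\mathcal{B})$ is $bb$-uniformizable; (3) $X$ is completely regular and $\mathcal{B}$ is saturated.
   Context: A bornology on a set $X$ is a set $\mathcal{B}\subseteq 2^X$ such that $\{x\}\in\mathcal{B}$ for each $x\in X$; $B\in\mathcal{B}$ and $A\subseteq B$ imply $A\in\mathcal{B}$; and $A\cup B\in\mathcal{B}$ whenever $A,B\in\mathcal{B}$. Elements of $\mathcal{B}$ are called bounded sets. A bornological universe $(X,\mathcal{B})$ is a topological space $X$ endowed with a bornology $\mathcal{B}$ on its underlying set. $\mathcal{C}_{\mathcal{B}}(X)$ is the set of all continuous real valued maps on $X$ that are bounded on every element of $\mathcal{B}$. The real line carries its usual topology and usual bornology of bounded sets. A source $(f_i:(X,\mathcal{B})\to(X_i,\mathcal{B}_i))_{i\in I}$ of bounded continuous maps is initial if $X$ carries the initial topology for the maps $f_i:X\to X_i$ and a set $B\subseteq X$ is in $\mathcal{B}$ iff $f_i(B)\in\mathcal{B}_i$ for each $i\in I$. So $\mathcal{C}_{\mathcal{B}}(X)$ is an initial source iff the topology of $X$ is the initial topology for the maps in $\mathcal{C}_{\mathcal{B}}(X)$ and $\mathcal{B}$ consists exactly of the sets $B\subseteq X$ such that $f(B)$ is a bounded subset of $\mathbb{R}$ for every $f\in\mathcal{C}_{\mathcal{B}}(X)$. A subset $B$ of a uniform space $(X,\mathcal{U})$ is bounded in the sense of Bourbaki if for each $U\in\mathcal{U}$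 there are $n\in\mathbb{N}$ and a finite set $K\subseteq X$ with $B\subseteq U^n(K)$, where $U^n$ is the $n$-fold composition of $U$. $(X,\mathcal{B})$ is $bb$-uniformizable if there is a uniformity $\mathcal{U}$ on $X$ whose underlying topology is the topology of $X$ and such that $\mathcal{B}$ is the set of subsets of $X$ that are bounded in the sense of Bourbaki for $\mathcal{U}$. Uniform spaces and completely regular spaces are not assumed to be Hausdorff. The bornology $\mathcal{B}$ on the topological space $X$ is saturated if it contains each $B\subseteq X$ that satisfies the following condition: for every sequence $(G_n)_{n\in\mathbb{N}}$ of open subsets of $X$ such that each element of $\mathcal{B}$ is contained in some $G_n$ and $\overline{G_n}\subseteq G_{n+1}$ for all $n\in\mathbb{N}$, there is an $m\in\mathbb{N}$ with $B\subseteq G_m$. *)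

theory Defs
  imports "HOL-Analysis.Analysis"
begin

text \<open>
  The pair \<open>(X, \<B>)\<close> is a bornological universe iff
  \<open>bornology_on (topspace X) \<B>\<close> holds.
\<close>

definition bornology_on :: "'a set \<Rightarrow> 'a set set \<Rightarrow> bool" where
  "bornology_on S \<B> \<longleftrightarrow>
     \<B> \<subseteq> Pow S \<and>
     (\<forall>x\<in>S. {x} \<in> \<B>) \<and>
     (\<forall>A B. B \<in> \<B> \<longrightarrow> A \<subseteq> B \<longrightarrow> A \<in> \<B>) \<and>
     (\<forall>A\<in>\<B>. \<forall>B\<in>\<B>. A \<union> B \<in> \<B>)"

text \<open>
  Maps are total functions on the ambient type; only their values on the carrier matter.
  The carrier \<open>S\<close> is inserted into the subbase so that the empty family also
  yields a topology on \<open>S\<close>.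
\<close>

definition initial_topology ::
    "'a set \<Rightarrow> 'i set \<Rightarrow> ('i \<Rightarrow> 'a \<Rightarrow> 'b) \<Rightarrow> ('i \<Rightarrow> 'b topology) \<Rightarrow> 'a topology" where
  "initial_topology S I f Y =
     topology_generated_by (insert S {S \<inter> f i -` V | i V. i \<in> I \<and> openin (Y i) V})"

lemma topspace_initial_topology [simp]: "topspace (initial_topology S I f Y) = S"
  by (auto simp: initial_topology_def)

definition initial_source ::
    "'a topology \<Rightarrow> 'a set set \<Rightarrow> 'i set \<Rightarrow> ('i \<Rightarrow> 'a \<Rightarrow> 'b)
      \<Rightarrow> ('i \<Rightarrow> 'b topology) \<Rightarrow> ('i \<Rightarrow> 'b set set) \<Rightarrow> bool" where
  "initial_source X \<B> I f Y \<C> \<longleftrightarrow>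
     (\<forall>i\<in>I. continuous_map X (Y i) (f i) \<and> (\<forall>B\<in>\<B>. f i ` B \<in> \<C> i)) \<and>
     X = initial_topology (topspace X) I f Y \<and>
     (\<forall>B. B \<subseteq> topspace X \<longrightarrow> (B \<in> \<B> \<longleftrightarrow> (\<forall>i\<in>I. f i ` B \<in> \<C> i)))"

definition real_bornology :: "real set set" where
  "real_bornology = {S. bounded S}"

lemma bornology_on_real_bornology: "bornology_on UNIV real_bornology"
  unfolding bornology_on_def real_bornology_def by (simp, meson bounded_subset)

definition bornological_C :: "'a topology \<Rightarrow> 'a set set \<Rightarrow> ('a \<Rightarrow> real) set" where
  "bornological_C X \<B> =
     {f. continuous_map X euclideanreal f \<and> (\<forall>B\<in>\<B>. f ` B \<in> real_bornology)}"

text \<open>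
  The family \<open>bornological_C X \<B>\<close> is indexed by itself.
\<close>

definition C_initial_source :: "'a topology \<Rightarrow> 'a set set \<Rightarrow> bool" where
  "C_initial_source X \<B> \<longleftrightarrow>
     initial_source X \<B> (bornological_C X \<B>) (\<lambda>f. f) (\<lambda>_. euclideanreal) (\<lambda>_. real_bornology)"

text \<open>
  The library's uniform spaces are a type class, with a fixed uniformity on a whole type; here
  one has to quantify over the uniformities on a given carrier. Uniformities are given by
  their entourages and need not be separated.
\<close>

definition uniform_structure_on :: "'a set \<Rightarrow> 'a rel set \<Rightarrow> bool" where
  "uniform_structure_on S \<U> \<longleftrightarrow>
     \<U> \<noteq> {} \<and>
     (\<forall>U\<in>\<U>. Id_on S \<subseteq> U \<and> U \<subseteq> S \<times> S) \<and>
     (\<forall>U V. U \<in> \<U> \<longrightarrow> U \<subseteq> V \<longrightarrow> V \<subseteq> S \<times> S \<longrightarrow> V \<in> \<U>) \<and>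
     (\<forall>U\<in>\<U>. \<forall>V\<in>\<U>. U \<inter> V \<in> \<U>) \<and>
     (\<forall>U\<in>\<U>. U\<inverse> \<in> \<U>) \<and>
     (\<forall>U\<in>\<U>. \<exists>V\<in>\<U>. V O V \<subseteq> U)"

definition uniform_topology :: "'a set \<Rightarrow> 'a rel set \<Rightarrow> 'a topology" where
  "uniform_topology S \<U> = topology (\<lambda>W. W \<subseteq> S \<and> (\<forall>x\<in>W. \<exists>U\<in>\<U>. U `` {x} \<subseteq> W))"

lemma openin_uniform_topology:
  assumes "uniform_structure_on S \<U>"
  shows "openin (uniform_topology S \<U>) W \<longleftrightarrow> W \<subseteq> S \<and> (\<forall>x\<in>W. \<exists>U\<in>\<U>. U `` {x} \<subseteq> W)"
proof -
  have "istopology (\<lambda>W. W \<subseteq> S \<and> (\<forall>x\<in>W. \<exists>U\<in>\<U>. U `` {x} \<subseteq> W))"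
    unfolding istopology_def
  proof (intro conjI allI impI ballI)
    fix A B x
    assume A: "A \<subseteq> S \<and> (\<forall>x\<in>A. \<exists>U\<in>\<U>. U `` {x} \<subseteq> A)"
      and B: "B \<subseteq> S \<and> (\<forall>x\<in>B. \<exists>U\<in>\<U>. U `` {x} \<subseteq> B)"
    show "A \<inter> B \<subseteq> S"
      using A by blast
    assume "x \<in> A \<inter> B"
    then obtain U V where "U \<in> \<U>" "U `` {x} \<subseteq> A" "V \<in> \<U>" "V `` {x} \<subseteq> B"
      using A B by blast
    moreover from this have "U \<inter> V \<in> \<U>"
      using assms by (simp add: uniform_structure_on_def)
    ultimately show "\<exists>U\<in>\<U>. U `` {x} \<subseteq> A \<inter> B"
      by blast
  next
    fix \<K> x
    assume K: "\<forall>K\<in>\<K>. K \<subseteq> S \<and> (\<forall>x\<in>K. \<exists>U\<in>\<U>. U `` {x} \<subseteq> K)"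
    show "\<Union>\<K> \<subseteq> S"
      using K by blast
    assume "x \<in> \<Union>\<K>"
    with K show "\<exists>U\<in>\<U>. U `` {x} \<subseteq> \<Union>\<K>"
      by (meson UnionE Union_upper subset_trans)
  qed
  then show ?thesis
    by (simp add: uniform_topology_def)
qed

lemma topspace_uniform_topology:
  assumes "uniform_structure_on S \<U>"
  shows "topspace (uniform_topology S \<U>) = S"
proof (rule antisym)
  have "\<U> \<noteq> {}" "\<forall>U\<in>\<U>. U \<subseteq> S \<times> S"
    using assms by (simp_all add: uniform_structure_on_def)
  then obtain U where U: "U \<in> \<U>" "U \<subseteq> S \<times> S"
    by blast
  then have "\<exists>U\<in>\<U>. U `` {x} \<subseteq> S" for x
    by blast
  then have "openin (uniform_topology S \<U>) S"
    unfolding openin_uniform_topology[OF assms] by blast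
  then show "S \<subseteq> topspace (uniform_topology S \<U>)"
    by (rule openin_subset)
  have "openin (uniform_topology S \<U>) (topspace (uniform_topology S \<U>))"
    by (rule openin_topspace)
  then show "topspace (uniform_topology S \<U>) \<subseteq> S"
    unfolding openin_uniform_topology[OF assms] by blast
qed

definition bourbaki_bounded :: "'a set \<Rightarrow> 'a rel set \<Rightarrow> 'a set \<Rightarrow> bool" where
  "bourbaki_bounded S \<U> B \<longleftrightarrow>
     B \<subseteq> S \<and> (\<forall>U\<in>\<U>. \<exists>(n::nat) K. finite K \<and> K \<subseteq> S \<and> B \<subseteq> (U ^^ n) `` K)"

definition bb_uniformizable :: "'a topology \<Rightarrow> 'a set set \<Rightarrow> bool" where
  "bb_uniformizable X \<B> \<longleftrightarrow>
     (\<exists>\<U>. uniform_structure_on (topspace X) \<U> \<and>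
          uniform_topology (topspace X) \<U> = X \<and>
          \<B> = {B. bourbaki_bounded (topspace X) \<U> B})"

definition saturated_bornology :: "'a topology \<Rightarrow> 'a set set \<Rightarrow> bool" where
  "saturated_bornology X \<B> \<longleftrightarrow>
     (\<forall>B. B \<subseteq> topspace X \<longrightarrow>
        (\<forall>G :: nat \<Rightarrow> 'a set.
           (\<forall>n. openin X (G n)) \<longrightarrow>
           (\<forall>A\<in>\<B>. \<exists>n. A \<subseteq> G n) \<longrightarrow>
           (\<forall>n. X closure_of G n \<subseteq> G (Suc n)) \<longrightarrow>
           (\<exists>m. B \<subseteq> G m)) \<longrightarrow>
        B \<in> \<B>)"

end

theory Submission
  imports Defs
begin

text \<open>
  The three conditions are proved equivalent in the cycle
  (1) \<open>\<Longrightarrow>\<close> (2) \<open>\<Longrightarrow>\<close> (3) \<open>\<Longrightarrow>\<close> (1).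

  From (1) to (2): the initial uniformity of any family \<open>C\<close> of real functions on \<open>S\<close> induces the
  initial topology (\<open>uniform_topology_function_uniformity\<close>), and the Bourbaki-bounded sets of this
  uniformity are exactly the sets on which every member of \<open>C\<close> is bounded
  (\<open>bourbaki_bounded_function_uniformity\<close>). One inclusion holds because \<open>f\<close> changes by less than
  \<open>n\<close> along a chain of \<open>n\<close> steps of length less than 1. For the other, finitely many functions that
  are bounded on \<open>B\<close> map \<open>B\<close> into a box, which is cut into finitely many small cells.

  From (2) to (3): complete regularity of a uniform space follows by Urysohn's dyadic construction,
  carried out with the relation "some entourage maps \<open>P\<close> into \<open>Q\<close>" in place of "the closure of
  \<open>P\<close> lies in the interior of \<open>Q\<close>": it implies the latter and can always be interpolated, while
  interpolating the latter would require normality. For saturation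
  (\<open>saturated_bourbaki_bounded\<close>), a set \<open>B\<close> that is not Bourbaki bounded for an entourage \<open>U\<close>
  contains points \<open>x\<^sub>0, x\<^sub>1, \<dots>\<close> such that \<open>x\<^sub>n\<close> is not reachable in \<open>n\<close> steps from the earlier
  ones. The points reachable in \<open>n\<close> steps from \<open>x\<^sub>0, \<dots>, x\<^bsub>n-1\<^esub>\<close>, together with the points not
  connected by \<open>U\<close>-chains to any \<open>x\<^sub>k\<close>, form sets \<open>E\<^sub>n\<close> with \<open>U[E\<^sub>n] \<subseteq> E\<^bsub>n+1\<^esub>\<close>. Each
  Bourbaki-bounded set lies in one of them, but none of them contains \<open>B\<close>, and their interiors are the open sets to
  which saturation applies.

  From (3) to (1): complete regularity makes the topology initial already for the continuous maps
  into \<open>[0,1]\<close>. If \<open>B\<close> is contained in no member of an exhaustion \<open>(G\<^sub>n)\<close> as in the definition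
  of saturation, then \<open>unbounded_function_on_exhaustion\<close> yields a continuous function that is
  bounded on each \<open>G\<^sub>n\<close>, hence on each bounded set, but not on \<open>B\<close>: it is the locally finite
  sum of bumps of height \<open>n\<close> at points \<open>x\<^sub>n \<in> B\<close> far out in the exhaustion, the \<open>n\<close>-th bump
  vanishing on \<open>G\<^sub>n\<close>. So a set on which all functions of \<open>\<C>\<^sub>\<B>(X)\<close> are bounded satisfies
  the condition in the definition of saturation.
\<close>

section \<open>Urysohn functions from interpolating relations\<close>

lemma dyadic_between:
  fixes a b :: real
  assumes "0 \<le> a" "a < b" "b \<le> 1"
  obtains d where "d \<in> dyadics \<inter> {0..1}" "a < d" "d < b"
proof -
  obtain n where n: "(1/2) ^ n < b - a"
    using real_arch_pow_inv[of "b - a" "1/2"] assms by auto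
  define m where "m = Suc (nat \<lfloor>a * 2 ^ n\<rfloor>)"
  define d :: real where "d = of_nat m / 2 ^ n"
  have m: "real m = of_int \<lfloor>a * 2 ^ n\<rfloor> + 1"
    using assms by (simp add: m_def)
  have "a * 2 ^ n < real m" "real m \<le> a * 2 ^ n + 1"
    unfolding m by linarith+
  then have "a < d" "d \<le> a + (1/2) ^ n"
    by (simp_all add: d_def field_simps)
  moreover have "d \<in> dyadics"
    by (auto simp: d_def dyadics_def)
  ultimately show thesis
    using that[of d] n assms by auto
qed

text \<open>
  Normality enters Urysohn's lemma only through the possibility of inserting a set between \<open>P\<close>
  and \<open>Q\<close> whenever the closure of \<open>P\<close> lies in the interior of \<open>Q\<close>. If a finer transitive
  relation \<open>R\<close> can be interpolated, the same construction works without normality: \<open>R\<close> gives sets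
  \<open>G d\<close> increasing in the dyadic \<open>d\<close>, and \<open>f y\<close> is the infimum of the \<open>d\<close> with \<open>y \<in> G d\<close>.
\<close>

lemma Urysohn_function_of_interpolating_relation:
  assumes R: "R A B"
    and interpolate: "\<And>P Q. R P Q \<Longrightarrow> \<exists>M. R P M \<and> R M Q"
    and trans: "\<And>P Q M. R P M \<Longrightarrow> R M Q \<Longrightarrow> R P Q"
    and inside: "\<And>P Q. R P Q \<Longrightarrow> X closure_of P \<subseteq> X interior_of Q"
  obtains f :: "'a \<Rightarrow> real" where "continuous_map X (top_of_set {0..1}) f"
    "f ` A \<subseteq> {0}" "f ` (topspace X - B) \<subseteq> {1}"
proof -
  let ?D = "dyadics \<inter> {0..1::real}"
  have "\<exists>G :: real \<Rightarrow> 'a set. G 0 = A \<and> G 1 = B \<and>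
      (\<forall>d\<in>?D. \<forall>e\<in>?D. d < e \<longrightarrow> R (G d) (G e))"
    by (rule recursion_on_dyadic_fractions) (fact R, fact interpolate, fact trans)
  then obtain G :: "real \<Rightarrow> 'a set" where G0: "G 0 = A" and G1: "G 1 = B"
    and G: "\<And>d e. d \<in> ?D \<Longrightarrow> e \<in> ?D \<Longrightarrow> d < e \<Longrightarrow> R (G d) (G e)"
    by metis
  have D01: "0 \<in> ?D" "1 \<in> ?D"
    by (force simp: dyadics_def)+
  \<comment> \<open>The element 1 gives the value of \<open>f\<close> at the points that lie in no \<open>G d\<close>.\<close>
  define f where "f y = Inf (insert 1 {d \<in> ?D. y \<in> G d})" for y
  have bdd: "bdd_below (insert 1 {d \<in> ?D. y \<in> G d})" for y
    by (rule bdd_belowI[of _ 0]) auto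
  have f_less_iff: "f y < a \<longleftrightarrow> 1 < a \<or> (\<exists>d\<in>?D. y \<in> G d \<and> d < a)" for y a
    unfolding f_def by (subst cInf_less_iff[OF _ bdd]) auto
  have f_range: "0 \<le> f y" "f y \<le> 1" for y
    using f_less_iff[of y 0] f_def cInf_lower[OF _ bdd, of 1 y] by force+
  have inside': "y \<in> X interior_of (G e)"
    if "d \<in> ?D" "e \<in> ?D" "d < e" "y \<in> X closure_of G d" for d e y
    using inside[OF G[OF that(1-3)]] that(4) by blast
  have mono: "y \<in> G e" if "d \<in> ?D" "e \<in> ?D" "d < e" "y \<in> G d" "y \<in> topspace X" for d e y
    using inside'[OF that(1-3), of y] that(4,5) interior_of_subset[of X "G e"]
    by (meson in_closure_of in_mono)
  have "openin X {y \<in> topspace X. f y < a}" for a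
  proof (subst openin_subopen, safe)
    fix y assume y: "y \<in> topspace X" "f y < a"
    show "\<exists>T. openin X T \<and> y \<in> T \<and> T \<subseteq> {y \<in> topspace X. f y < a}"
    proof (cases "1 < a")
      case True
      then show ?thesis
        using y f_less_iff by (intro exI[of _ "topspace X"]) auto
    next
      case False
      with y obtain d where d: "d \<in> ?D" "y \<in> G d" "d < a"
        using f_less_iff[of y a] by auto
      obtain e where e: "e \<in> ?D" "d < e" "e < a"
        using dyadic_between[of d a] d False by auto
      have "y \<in> X interior_of (G e)"
        using inside'[OF d(1) e(1,2)] y d(2) by (meson in_closure_of)
      moreover have "X interior_of (G e) \<subseteq> {y \<in> topspace X. f y < a}"
        using f_less_iff e interior_of_subset[of X "G e"] interior_of_subset_topspace[of X "G e"]
        by auto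
      ultimately show ?thesis
        by (meson openin_interior_of)
    qed
  qed
  moreover have "openin X {y \<in> topspace X. f y > a}" for a
  proof (subst openin_subopen, safe)
    fix y assume y: "y \<in> topspace X" "a < f y"
    show "\<exists>T. openin X T \<and> y \<in> T \<and> T \<subseteq> {y \<in> topspace X. f y > a}"
    proof (cases "a < 0")
      case True
      then show ?thesis
        using y f_range(1) by (intro exI[of _ "topspace X"]) (auto intro: less_le_trans)
    next
      case False
      then obtain d where d: "d \<in> ?D" "a < d" "d < f y"
        using dyadic_between[of a "f y"] y f_range(2)[of y] by auto
      obtain e where e: "e \<in> ?D" "d < e" "e < f y"
        using dyadic_between[of d "f y"] d f_range(2)[of y] by auto
      have "y \<notin> G e"
        using e f_less_iff[of y "f y"] by auto
      then have "y \<notin> X closure_of (G d)"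
        using inside'[OF d(1) e(1,2)] interior_of_subset[of X "G e"] by blast
      moreover have "f z > a" if z: "z \<in> topspace X - X closure_of (G d)" for z
      proof -
        have zd: "z \<notin> G d" "z \<in> topspace X"
          using z by (auto simp: in_closure_of)
        have "\<not> f z < d"
          using f_less_iff[of z d] mono[OF _ d(1) _ _ zd(2)] zd(1) d(1) by fastforce
        then show ?thesis
          using d(2) by linarith
      qed
      ultimately show ?thesis
        using y by (intro exI[of _ "topspace X - X closure_of (G d)"]) (auto simp: openin_diff)
    qed
  qed
  ultimately have "continuous_map X (top_of_set {0..1}) f"
    using f_range by (subst continuous_map_upper_lower_semicontinuous_lt_gen) auto
  moreover have "f y = 0" if "y \<in> A" for y
    using f_range(1)[of y] cInf_lower[OF _ bdd, of 0 y] that D01 G0 by (force simp: f_def)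
  moreover have "f y = 1" if "y \<in> topspace X - B" for y
  proof -
    have "y \<notin> G d" if d: "d \<in> ?D" for d
      using mono[OF d D01(2)] \<open>y \<in> topspace X - B\<close> G1 d by (cases "d = 1") auto
    then have "\<not> f y < 1"
      using f_less_iff[of y 1] by auto
    then show ?thesis
      using f_range(2)[of y] by linarith
  qed
  ultimately show thesis
    using that by blast
qed

section \<open>Uniform spaces\<close>

lemma uniform_structure_onD:
  assumes "uniform_structure_on S \<U>" "U \<in> \<U>"
  shows "x \<in> S \<Longrightarrow> (x, x) \<in> U" "U \<subseteq> S \<times> S" "V \<in> \<U> \<Longrightarrow> U \<inter> V \<in> \<U>" "U\<inverse> \<in> \<U>"
    "\<exists>V\<in>\<U>. V O V \<subseteq> U"
  using assms unfolding uniform_structure_on_def by (simp_all add: Id_on_def subset_iff)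

text \<open>
  Openness of a set asks each of its points for an entourage section inside it. The point here is
  that a section inside \<open>B\<close> is a neighbourhood even when \<open>B\<close> is not open: halving \<open>U\<close> shows that
  the points having a section inside \<open>B\<close> form an open set.
\<close>

lemma in_interior_of_uniform_topology:
  assumes \<U>: "uniform_structure_on S \<U>" and "x \<in> S"
  shows "x \<in> uniform_topology S \<U> interior_of B \<longleftrightarrow> (\<exists>U\<in>\<U>. U `` {x} \<subseteq> B)"
proof
  assume "x \<in> uniform_topology S \<U> interior_of B"
  then obtain T where "openin (uniform_topology S \<U>) T" "x \<in> T" "T \<subseteq> B"
    by (auto simp: interior_of_def)
  then show "\<exists>U\<in>\<U>. U `` {x} \<subseteq> B"
    unfolding openin_uniform_topology[OF \<U>] by blast
next
  let ?I = "{y \<in> S. \<exists>U\<in>\<U>. U `` {y} \<subseteq> B}"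
  have "\<exists>V\<in>\<U>. V `` {y} \<subseteq> ?I" if U: "U \<in> \<U>" "U `` {y} \<subseteq> B" for y U
  proof -
    obtain V where V: "V \<in> \<U>" "V O V \<subseteq> U"
      using uniform_structure_onD(5)[OF \<U> U(1)] by blast
    have "V `` {y} \<subseteq> ?I"
      using V U uniform_structure_onD(2)[OF \<U> V(1)] by blast
    with V show ?thesis
      by blast
  qed
  then have "openin (uniform_topology S \<U>) ?I"
    unfolding openin_uniform_topology[OF \<U>] by blast
  moreover have "?I \<subseteq> B"
    using uniform_structure_onD(1)[OF \<U>] by blast
  moreover assume "\<exists>U\<in>\<U>. U `` {x} \<subseteq> B"
  ultimately show "x \<in> uniform_topology S \<U> interior_of B"
    using \<open>x \<in> S\<close> interior_of_maximal by blast
qed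

text \<open>
  A point \<open>y\<close> of the closure of \<open>A\<close> is \<open>V\<close>-close to some \<open>a \<in> A\<close>, so with \<open>V O V \<subseteq> U\<close> a whole
  \<open>V\<close>-section at \<open>y\<close> stays within \<open>U `` A\<close>.
\<close>

lemma closure_of_subset_interior_of_uniform_topology:
  assumes \<U>: "uniform_structure_on S \<U>" and U: "U \<in> \<U>" "U `` A \<subseteq> B"
  shows "uniform_topology S \<U> closure_of A \<subseteq> uniform_topology S \<U> interior_of B"
proof
  let ?X = "uniform_topology S \<U>"
  fix y assume y: "y \<in> ?X closure_of A"
  then have "y \<in> S"
    using topspace_uniform_topology[OF \<U>] by (simp add: in_closure_of)
  obtain V where V: "V \<in> \<U>" "V O V \<subseteq> U"
    using uniform_structure_onD(5)[OF \<U> U(1)] by blast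
  have "V\<inverse> \<in> \<U>"
    using uniform_structure_onD(4)[OF \<U> V(1)] .
  then have "y \<in> ?X interior_of (V\<inverse> `` {y})"
    using in_interior_of_uniform_topology[OF \<U> \<open>y \<in> S\<close>] by blast
  then obtain a where "a \<in> A" "a \<in> ?X interior_of (V\<inverse> `` {y})"
    using y openin_interior_of unfolding in_closure_of by metis
  then have "(a, y) \<in> V"
    using interior_of_subset by fastforce
  then have "V `` {y} \<subseteq> B"
    using V U \<open>a \<in> A\<close> by blast
  then show "y \<in> ?X interior_of B"
    using in_interior_of_uniform_topology[OF \<U> \<open>y \<in> S\<close>] V by blast
qed

text \<open>
  The relation "some entourage maps \<open>P\<close> into \<open>Q\<close>" is interpolated by \<open>V `` P\<close>, where
  \<open>V O V \<subseteq> U\<close>.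
\<close>

lemma completely_regular_uniform_topology:
  assumes \<U>: "uniform_structure_on S \<U>"
  shows "completely_regular_space (uniform_topology S \<U>)"
  unfolding completely_regular_space_def
proof (intro allI impI, elim conjE)
  let ?X = "uniform_topology S \<U>"
  fix C x assume C: "closedin ?X C" and x: "x \<in> topspace ?X - C"
  define R where "R P Q \<longleftrightarrow> (\<exists>U\<in>\<U>. U `` P \<subseteq> Q) \<and> P \<subseteq> S" for P Q
  have "openin ?X (topspace ?X - C)"
    using C by blast
  then have "\<exists>U\<in>\<U>. U `` {x} \<subseteq> topspace ?X - C"
    using x unfolding openin_uniform_topology[OF \<U>] by blast
  then have "R {x} (topspace ?X - C)"
    using x topspace_uniform_topology[OF \<U>] by (simp add: R_def)
  moreover have "\<exists>M. R P M \<and> R M Q" if PQ: "R P Q" for P Q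
  proof -
    obtain U where U: "U \<in> \<U>" "U `` P \<subseteq> Q"
      using PQ R_def by blast
    obtain V where V: "V \<in> \<U>" "V O V \<subseteq> U"
      using uniform_structure_onD(5)[OF \<U> U(1)] by blast
    have "V `` (V `` P) \<subseteq> Q" "V `` P \<subseteq> S"
      using U V uniform_structure_onD(2)[OF \<U> V(1)] by blast+
    then show ?thesis
      using V PQ unfolding R_def by blast
  qed
  moreover have "R P Q" if "R P M" "R M Q" for P Q M
  proof -
    have "P \<subseteq> M"
      using that(1) uniform_structure_onD(1)[OF \<U>] unfolding R_def by blast
    then show ?thesis
      using that unfolding R_def by blast
  qed
  moreover have "?X closure_of P \<subseteq> ?X interior_of Q" if "R P Q" for P Q
    using that closure_of_subset_interior_of_uniform_topology[OF \<U>] unfolding R_def by blast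
  ultimately obtain f :: "'a \<Rightarrow> real" where
    "continuous_map ?X (top_of_set {0..1}) f" "f ` {x} \<subseteq> {0}"
    "f ` (topspace ?X - (topspace ?X - C)) \<subseteq> {1}"
    by (rule Urysohn_function_of_interpolating_relation)
  moreover have "topspace ?X - (topspace ?X - C) = C"
    using closedin_subset[OF C] by blast
  ultimately show "\<exists>f::'a\<Rightarrow>real. continuous_map ?X (top_of_set {0..1}) f \<and> f x = 0 \<and> f ` C \<subseteq> {1}"
    by auto
qed

lemma relpow_Suc_Image: "(U ^^ Suc n) `` K = U `` ((U ^^ n) `` K)"
  by (simp add: relcomp_Image)

text \<open>
  If \<open>B\<close> is not Bourbaki bounded, an exhaustion is needed that absorbs every
  Bourbaki-bounded set although none of its members contains \<open>B\<close>. Balls around finitely many points of \<open>B\<close> are not enough,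
  since they miss everything that is not connected to these points by \<open>U\<close>-chains. Adding all points
  unreachable from the chosen sequence to every member handles at once the case that \<open>B\<close> meets
  infinitely many chain components and the case that \<open>B\<close> is unbounded within one of them.
\<close>

lemma saturated_bourbaki_bounded:
  assumes \<U>: "uniform_structure_on S \<U>"
  shows "saturated_bornology (uniform_topology S \<U>) {B. bourbaki_bounded S \<U> B}"
  unfolding saturated_bornology_def topspace_uniform_topology[OF \<U>]
proof (intro allI impI, rule ccontr)
  let ?X = "uniform_topology S \<U>"
  fix B assume B: "B \<subseteq> S" "B \<notin> {B. bourbaki_bounded S \<U> B}"
    and sat: "\<forall>G. (\<forall>n. openin ?X (G n)) \<longrightarrow>
      (\<forall>A\<in>{B. bourbaki_bounded S \<U> B}. \<exists>n::nat. A \<subseteq> G n) \<longrightarrow>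
      (\<forall>n. ?X closure_of G n \<subseteq> G (Suc n)) \<longrightarrow> (\<exists>m. B \<subseteq> G m)"
  have "\<exists>U\<in>\<U>. \<forall>n K. finite K \<longrightarrow> K \<subseteq> S \<longrightarrow> \<not> B \<subseteq> (U ^^ n) `` K"
    using B unfolding bourbaki_bounded_def by simp metis
  then obtain U\<^sub>0 where U\<^sub>0: "U\<^sub>0 \<in> \<U>"
      "\<And>n K. finite K \<Longrightarrow> K \<subseteq> S \<Longrightarrow> \<not> B \<subseteq> (U\<^sub>0 ^^ n) `` K"
    by metis
  \<comment> \<open>Symmetry is needed so that no step of \<open>U\<close> enters a chain component from outside.\<close>
  define U where "U = U\<^sub>0 \<inter> U\<^sub>0\<inverse>"
  have U: "U \<in> \<U>"
    unfolding U_def using uniform_structure_onD(3,4)[OF \<U> U\<^sub>0(1)] by blast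
  have sym: "(y, x) \<in> U" if "(x, y) \<in> U" for x y
    using that by (auto simp: U_def)
  have US: "U \<subseteq> S \<times> S" and refl: "\<And>x. x \<in> S \<Longrightarrow> (x, x) \<in> U"
    using uniform_structure_onD(1,2)[OF \<U> U] by auto
  have "U ^^ n \<subseteq> U\<^sub>0 ^^ n" for n
    by (induction n) (auto simp: U_def)
  then have unbounded: "\<not> B \<subseteq> (U ^^ n) `` K" if "finite K" "K \<subseteq> S" for n K
    using U\<^sub>0(2)[OF that, of n] by blast

  \<comment> \<open>\<open>K n\<close> collects \<open>x 0, ..., x (n - 1)\<close>, each chosen in \<open>B\<close> out of reach of the previous ones.\<close>
  define K where
    "K = rec_nat {} (\<lambda>n L. insert (SOME x. x \<in> B \<and> x \<notin> (U ^^ n) `` L) L)"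
  define x where "x n = (SOME x. x \<in> B \<and> x \<notin> (U ^^ n) `` K n)" for n
  have K_0: "K 0 = {}" and K_Suc: "K (Suc n) = insert (x n) (K n)" for n
    by (simp_all add: K_def x_def)
  have K: "finite (K n) \<and> K n \<subseteq> B" for n
  proof (induction n)
    case (Suc n)
    then have "\<exists>x. x \<in> B \<and> x \<notin> (U ^^ n) `` K n"
      using unbounded[of "K n" n] B by blast
    from someI_ex[OF this] show ?case
      using Suc by (simp add: K_Suc x_def)
  qed (simp add: K_0)
  have x: "x n \<in> B" "x n \<notin> (U ^^ n) `` K n" for n
  proof -
    have "\<exists>x. x \<in> B \<and> x \<notin> (U ^^ n) `` K n"
      using unbounded[of "K n" n] B K[of n] by blast
    from someI_ex[OF this] show "x n \<in> B" "x n \<notin> (U ^^ n) `` K n"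
      by (simp_all add: x_def)
  qed

  define P where "P n = (U ^^ n) `` K n" for n
  define E where "E n = P n \<union> (S - (\<Union>m. P m))" for n
  have U_P: "U `` P n \<subseteq> P (Suc n)" for n
    unfolding P_def relpow_Suc_Image by (auto simp: K_Suc)
  have P_S: "P n \<subseteq> S" for n
  proof (induction n)
    case (Suc n)
    then show ?case
      unfolding P_def relpow_Suc_Image using US by blast
  qed (simp add: P_def K_0)
  have U_E: "U `` E n \<subseteq> E (Suc n)" for n
  proof
    fix z assume "z \<in> U `` E n"
    then obtain y where y: "y \<in> E n" "(y, z) \<in> U"
      by blast
    show "z \<in> E (Suc n)"
    proof (cases "y \<in> P n")
      case True
      then show ?thesis
        using U_P y by (auto simp: E_def)
    next
      case False
      have "z \<notin> P m" for m
        using U_P[of m] sym[OF y(2)] y(1) False unfolding E_def by blast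
      then show ?thesis
        using y US by (auto simp: E_def)
    qed
  qed
  have E_S: "E n \<subseteq> S" for n
    using P_S by (auto simp: E_def)
  have E_Suc: "E n \<subseteq> E (Suc n)" for n
    using U_E[of n] E_S[of n] refl by blast
  have E_mono: "E m \<subseteq> E n" if "m \<le> n" for m n
    using lift_Suc_mono_le[of E, OF E_Suc that] .
  have E_cover: "\<exists>n. y \<in> E n" if "y \<in> S" for y
    using that by (auto simp: E_def)
  have E_fin: "\<exists>n. L \<subseteq> E n" if "finite L" "L \<subseteq> S" for L
    using that
  proof (induction L)
    case (insert y L)
    then obtain m n where "L \<subseteq> E m" "y \<in> E n"
      using E_cover by blast
    then have "insert y L \<subseteq> E (max m n)"
      using E_mono[of m "max m n"] E_mono[of n "max m n"] by auto
    then show ?case ..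
  qed simp
  have E_pow: "(U ^^ n) `` E m \<subseteq> E (m + n)" for m n
  proof (induction n)
    case (Suc n)
    then show ?case
      unfolding relpow_Suc_Image using U_E[of "m + n"] by auto
  qed simp

  define G where "G n = ?X interior_of (E n)" for n
  \<comment> \<open>The sets \<open>E n\<close> need not be open; passing to interiors costs one step of the exhaustion.\<close>
  have closure_E: "?X closure_of E n \<subseteq> G (Suc n)" for n
    unfolding G_def by (rule closure_of_subset_interior_of_uniform_topology[OF \<U> U U_E])
  have "?X closure_of G n \<subseteq> G (Suc n)" for n
    using closure_E[of n] closure_of_mono[OF interior_of_subset[of ?X "E n"], of ?X]
    unfolding G_def by blast
  moreover have "\<exists>n. A \<subseteq> G n" if "bourbaki_bounded S \<U> A" for A
  proof -
    obtain n L where L: "finite L" "L \<subseteq> S" "A \<subseteq> (U ^^ n) `` L"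
      using \<open>bourbaki_bounded S \<U> A\<close> U unfolding bourbaki_bounded_def by blast
    obtain m where "L \<subseteq> E m"
      using E_fin L by blast
    then have "A \<subseteq> E (m + n)"
      using L(3) E_pow[of n m] by blast
    then have "A \<subseteq> G (Suc (m + n))"
      using closure_E[of "m + n"] E_S[of "m + n"] closure_of_subset[of "E (m + n)" ?X]
      unfolding topspace_uniform_topology[OF \<U>] by blast
    then show ?thesis ..
  qed
  moreover have "openin ?X (G n)" for n
    by (simp add: G_def)
  ultimately obtain m where "B \<subseteq> G m"
    using sat by blast
  then have "x m \<in> E m"
    using x(1)[of m] interior_of_subset[of ?X "E m"] unfolding G_def by blast
  \<comment> \<open>\<open>x m\<close> itself is reachable, so it is not among the points added to every \<open>E n\<close>.\<close>
  moreover have "x m \<in> P (Suc m)"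
  proof -
    have "x m \<in> S"
      using x(1)[of m] B(1) by blast
    then have "(x m, x m) \<in> U ^^ k" for k
      by (induction k) (use refl in auto)
    moreover have "x m \<in> K (Suc m)"
      by (simp add: K_Suc)
    ultimately show ?thesis
      unfolding P_def by (rule ImageI)
  qed
  ultimately show False
    using x(2)[of m] unfolding E_def P_def[symmetric] by blast
qed

section \<open>The uniformity induced by a family of real functions\<close>

definition function_entourage :: "'a set \<Rightarrow> ('a \<Rightarrow> real) set \<Rightarrow> real \<Rightarrow> 'a rel" where
  "function_entourage S F e = {(x, y) \<in> S \<times> S. \<forall>f\<in>F. \<bar>f x - f y\<bar> < e}"

definition function_uniformity :: "'a set \<Rightarrow> ('a \<Rightarrow> real) set \<Rightarrow> 'a rel set" where
  "function_uniformity S C =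
     {U. U \<subseteq> S \<times> S \<and> (\<exists>F e. finite F \<and> F \<subseteq> C \<and> 0 < e \<and> function_entourage S F e \<subseteq> U)}"

lemma function_entourage_in_uniformity:
  assumes "finite F" "F \<subseteq> C" "0 < e"
  shows "function_entourage S F e \<in> function_uniformity S C"
  using assms by (auto simp: function_uniformity_def function_entourage_def)

lemma function_uniformityE:
  assumes "U \<in> function_uniformity S C"
  obtains F e where "finite F" "F \<subseteq> C" "0 < e" "function_entourage S F e \<subseteq> U" "U \<subseteq> S \<times> S"
  using assms by (auto simp: function_uniformity_def)

lemma uniform_structure_function_uniformity:
  "uniform_structure_on S (function_uniformity S C)"
  unfolding uniform_structure_on_def
proof (intro conjI ballI allI impI)
  show "function_uniformity S C \<noteq> {}"
    using function_entourage_in_uniformity[of "{}" C 1 S] by auto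
next
  fix U assume U: "U \<in> function_uniformity S C"
  then obtain F e where F: "finite F" "F \<subseteq> C" "0 < e" "function_entourage S F e \<subseteq> U" "U \<subseteq> S \<times> S"
    by (rule function_uniformityE)
  show "Id_on S \<subseteq> U"
    using F(3,4) by (auto simp: function_entourage_def)
  show "U \<subseteq> S \<times> S"
    by fact
  show "V \<in> function_uniformity S C" if "U \<subseteq> V" "V \<subseteq> S \<times> S" for V
    using F that unfolding function_uniformity_def by blast
  have "(function_entourage S F e)\<inverse> = function_entourage S F e"
    by (auto simp: function_entourage_def abs_minus_commute)
  then have "function_entourage S F e \<subseteq> U\<inverse>"
    using F(4) converse_mono by metis
  then show "U\<inverse> \<in> function_uniformity S C"
    using F unfolding function_uniformity_def by blast
  have "function_entourage S F (e/2) O function_entourage S F (e/2) \<subseteq> function_entourage S F e"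
  proof clarify
    fix x y z
    assume "(x, y) \<in> function_entourage S F (e/2)" "(y, z) \<in> function_entourage S F (e/2)"
    moreover have "\<bar>f x - f z\<bar> < e" if "\<bar>f x - f y\<bar> < e/2" "\<bar>f y - f z\<bar> < e/2" for f :: "'a \<Rightarrow> real"
      using that by linarith
    ultimately show "(x, z) \<in> function_entourage S F e"
      unfolding function_entourage_def by blast
  qed
  then show "\<exists>V\<in>function_uniformity S C. V O V \<subseteq> U"
    using F function_entourage_in_uniformity[of F C "e/2" S] by (meson half_gt_zero subset_trans)
  fix V assume "V \<in> function_uniformity S C"
  then obtain F' e' where F': "finite F'" "F' \<subseteq> C" "0 < e'" "function_entourage S F' e' \<subseteq> V"
    by (rule function_uniformityE)
  have "function_entourage S (F \<union> F') (min e e') \<subseteq> U \<inter> V"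
    using F(4) F'(4) by (fastforce simp: function_entourage_def)
  then show "U \<inter> V \<in> function_uniformity S C"
    using F F' unfolding function_uniformity_def
    by (intro CollectI conjI exI[of _ "F \<union> F'"] exI[of _ "min e e'"]) auto
qed

lemma openin_initial_topology_preimage:
  assumes "i \<in> I" "openin (Y i) V"
  shows "openin (initial_topology S I f Y) (S \<inter> f i -` V)"
  unfolding initial_topology_def using assms by (intro topology_generated_by_Basis) blast

lemma openin_initial_topology_coarsest:
  assumes "openin (initial_topology S I f Y) W" "openin X S"
    and "\<And>i V. i \<in> I \<Longrightarrow> openin (Y i) V \<Longrightarrow> openin X (S \<inter> f i -` V)"
  shows "openin X W"
proof (rule generate_topology_on_coarsest[where T = "openin X"])
  show "generate_topology_on (insert S {S \<inter> f i -` V | i V. i \<in> I \<and> openin (Y i) V}) W"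
    using assms(1) unfolding initial_topology_def by (rule openin_topology_generated_by)
qed (use assms(2,3) in auto)

lemma uniform_topology_function_uniformity:
  fixes C :: "('a \<Rightarrow> real) set"
  shows "uniform_topology S (function_uniformity S C) =
         initial_topology S C (\<lambda>f. f) (\<lambda>_. euclideanreal)" (is "?U = ?I")
proof (rule topology_eq[THEN iffD2], intro allI iffI)
  note unif = uniform_structure_function_uniformity[of S C]
  fix W
  assume W: "openin ?U W"
  show "openin ?I W"
  proof (subst openin_subopen, intro ballI)
    fix x assume "x \<in> W"
    then obtain U where "U \<in> function_uniformity S C" and UW: "U `` {x} \<subseteq> W"
      using W unfolding openin_uniform_topology[OF unif] by blast
    from this(1) obtain F e where F: "finite F" "F \<subseteq> C" "0 < e" "function_entourage S F e \<subseteq> U"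
      by (rule function_uniformityE)
    have "x \<in> S"
      using W \<open>x \<in> W\<close> unfolding openin_uniform_topology[OF unif] by blast
    let ?T = "\<Inter>(insert S ((\<lambda>f. S \<inter> f -` ball (f x) e) ` F))"
    have "openin ?I ?T"
    proof (rule openin_Inter)
      fix T assume "T \<in> insert S ((\<lambda>f. S \<inter> f -` ball (f x) e) ` F)"
      then show "openin ?I T"
        using F(2) openin_topspace[of ?I]
          openin_initial_topology_preimage[of _ C "\<lambda>_. euclideanreal" "ball _ e" S "\<lambda>f. f"]
        by auto
    qed (use F(1) in auto)
    moreover have "x \<in> ?T"
      using \<open>x \<in> S\<close> F(3) by simp
    moreover have "?T \<subseteq> W"
      using UW F(4) \<open>x \<in> S\<close> unfolding function_entourage_def by (auto simp: dist_real_def)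
    ultimately show "\<exists>T. openin ?I T \<and> x \<in> T \<and> T \<subseteq> W"
      by blast
  qed
next
  note unif = uniform_structure_function_uniformity[of S C]
  fix W assume "openin ?I W"
  then show "openin ?U W"
  proof (rule openin_initial_topology_coarsest)
    show "openin ?U S"
      using openin_topspace[of ?U] topspace_uniform_topology[OF unif] by simp
    fix f :: "'a \<Rightarrow> real" and V assume f: "f \<in> C" and V: "openin euclideanreal V"
    have "\<exists>U\<in>function_uniformity S C. U `` {x} \<subseteq> S \<inter> f -` V" if x: "x \<in> S \<inter> f -` V" for x
    proof -
      obtain e where e: "0 < e" "ball (f x) e \<subseteq> V"
        using V x openE by auto
      have "function_entourage S {f} e `` {x} \<subseteq> S \<inter> f -` V"
        using e by (auto simp: function_entourage_def dist_real_def subset_iff)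
      then show ?thesis
        using function_entourage_in_uniformity[of "{f}" C e S] e f by auto
    qed
    then show "openin ?U (S \<inter> f -` V)"
      unfolding openin_uniform_topology[OF unif] by blast
  qed
qed

lemma relpow_function_entourage:
  assumes "(x, y) \<in> function_entourage S {f} 1 ^^ n"
  shows "\<bar>f x - f y\<bar> \<le> real n"
  using assms
proof (induction n arbitrary: y)
  case (Suc n)
  then obtain z where "\<bar>f x - f z\<bar> \<le> real n" "\<bar>f z - f y\<bar> < 1"
    by (auto simp: function_entourage_def)
  then show ?case
    by simp
qed simp

text \<open>
  An initial uniformity for real functions is special in that bounded sets are even totally
  bounded: a box in a finite power of \<open>\<real>\<close> splits into finitely many cells of side \<open>e\<close>, so
  \<open>n = 1\<close> suffices in the definition of Bourbaki boundedness.
\<close>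

lemma bourbaki_bounded_function_uniformity:
  "bourbaki_bounded S (function_uniformity S C) B \<longleftrightarrow> B \<subseteq> S \<and> (\<forall>f\<in>C. bounded (f ` B))"
proof (intro iffI conjI ballI)
  assume B: "bourbaki_bounded S (function_uniformity S C) B"
  then show "B \<subseteq> S"
    by (simp add: bourbaki_bounded_def)
  fix f assume "f \<in> C"
  then have "function_entourage S {f} 1 \<in> function_uniformity S C"
    by (intro function_entourage_in_uniformity) auto
  then obtain n K where K: "finite K" "B \<subseteq> (function_entourage S {f} 1 ^^ n) `` K"
    using B unfolding bourbaki_bounded_def by blast
  have "\<bar>f y\<bar> \<le> (\<Sum>x\<in>K. \<bar>f x\<bar>) + real n" if y: "y \<in> B" for y
  proof -
    obtain x where x: "x \<in> K" "(x, y) \<in> function_entourage S {f} 1 ^^ n"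
      using K(2) y by blast
    have "\<bar>f x\<bar> \<le> (\<Sum>x\<in>K. \<bar>f x\<bar>)"
      using K(1) x(1) by (intro member_le_sum) auto
    then show ?thesis
      using relpow_function_entourage[OF x(2)] by linarith
  qed
  then show "bounded (f ` B)"
    unfolding bounded_iff by auto
next
  assume B: "B \<subseteq> S \<and> (\<forall>f\<in>C. bounded (f ` B))"
  show "bourbaki_bounded S (function_uniformity S C) B"
    unfolding bourbaki_bounded_def
  proof (intro conjI ballI)
    fix U assume "U \<in> function_uniformity S C"
    then obtain F e where F: "finite F" "F \<subseteq> C" "0 < e" "function_entourage S F e \<subseteq> U"
      by (rule function_uniformityE)
    \<comment> \<open>Points in the same cell are \<open>e\<close>-close under each \<open>f \<in> F\<close>; \<open>B\<close> meets only finitely many cells.\<close>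
    define cell where "cell y = restrict (\<lambda>f. \<lfloor>f y / e\<rfloor>) F" for y
    have fin: "finite ((\<lambda>y. \<lfloor>f y / e\<rfloor>) ` B)" if f: "f \<in> F" for f
    proof -
      obtain c where c: "\<And>y. y \<in> B \<Longrightarrow> \<bar>f y\<bar> \<le> c"
        using B F(2) f unfolding bounded_iff by (metis image_eqI real_norm_def subsetD)
      have "\<lfloor>f y / e\<rfloor> \<in> {\<lfloor>- c / e\<rfloor>..\<lfloor>c / e\<rfloor>}" if "y \<in> B" for y
        using c[OF that] F(3) by (auto intro!: floor_mono divide_right_mono simp del: divide_minus_left)
      then have "(\<lambda>y. \<lfloor>f y / e\<rfloor>) ` B \<subseteq> {\<lfloor>- c / e\<rfloor>..\<lfloor>c / e\<rfloor>}"
        by blast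
      then show ?thesis
        using finite_subset by blast
    qed
    have "cell ` B \<subseteq> (\<Pi>\<^sub>E f\<in>F. (\<lambda>y. \<lfloor>f y / e\<rfloor>) ` B)"
      by (auto simp: cell_def)
    then have "finite (cell ` B)"
      by (rule finite_subset) (rule finite_PiE[OF F(1) fin])
    then obtain K where K: "K \<subseteq> B" "finite K" "cell ` B = cell ` K"
      using finite_subset_image[of "cell ` B" cell B] by blast
    have "y \<in> U `` K" if y: "y \<in> B" for y
    proof -
      obtain x where x: "x \<in> K" "cell x = cell y"
        using K(3) y by force
      have "\<bar>f x - f y\<bar> < e" if "f \<in> F" for f
      proof -
        have "\<lfloor>f x / e\<rfloor> = \<lfloor>f y / e\<rfloor>"
          using fun_cong[OF x(2), of f] that by (simp add: cell_def)
        then have "\<bar>f x / e - f y / e\<bar> < 1"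
          by linarith
        then show ?thesis
          using F(3) by (simp add: abs_if field_simps split: if_splits)
      qed
      then have "(x, y) \<in> function_entourage S F e"
        using x(1) K(1) B y by (auto simp: function_entourage_def)
      then show ?thesis
        using F(4) x(1) by blast
    qed
    then have "B \<subseteq> (U ^^ 1) `` K"
      by auto
    then show "\<exists>n K. finite K \<and> K \<subseteq> S \<and> B \<subseteq> (U ^^ n) `` K"
      using K B by blast
  qed (use B in blast)
qed

section \<open>Saturated bornologies on completely regular spaces\<close>

text \<open>
  The point \<open>x n\<close> is chosen in \<open>B\<close> outside \<open>G (Suc n)\<close>, hence outside the closure of \<open>G n\<close>, so
  complete regularity alone gives a bump of height \<open>n\<close> at \<open>x n\<close> that vanishes on \<open>G n\<close>. On
  \<open>G n\<close> only the first \<open>n\<close> bumps contribute to their sum; being nonnegative, they do not cancel.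
\<close>

lemma unbounded_function_on_exhaustion:
  fixes G :: "nat \<Rightarrow> 'a set"
  assumes X: "completely_regular_space X"
    and G_open: "\<And>n. openin X (G n)"
    and G_closure: "\<And>n. X closure_of G n \<subseteq> G (Suc n)"
    and G_cover: "topspace X \<subseteq> (\<Union>n. G n)"
    and B: "B \<subseteq> topspace X" "\<And>n. \<not> B \<subseteq> G n"
  obtains F :: "'a \<Rightarrow> real" where "continuous_map X euclideanreal F"
    "\<And>n. bounded (F ` G n)" "\<not> bounded (F ` B)"
proof -
  have G_Suc: "G n \<subseteq> G (Suc n)" for n
    using G_closure[of n] closure_of_subset[OF openin_subset[OF G_open[of n]]] by blast
  have G_mono: "G m \<subseteq> G n" if "m \<le> n" for m n
    using lift_Suc_mono_le[of G, OF G_Suc that] .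
  have "\<exists>y. y \<in> B \<and> y \<notin> G (Suc n)" for n
    using B(2)[of "Suc n"] by blast
  then obtain x where x: "\<And>n. x n \<in> B" "\<And>n. x n \<notin> G (Suc n)"
    by metis
  have "\<exists>g::'a\<Rightarrow>real. continuous_map X (top_of_set {0..1}) g \<and> g (x n) = 0 \<and>
          g ` (X closure_of G n) \<subseteq> {1}" for n
    using X x(1)[of n] x(2)[of n] B(1) G_closure[of n]
    unfolding completely_regular_space_def
    by (metis DiffI closedin_closure_of in_mono)
  then obtain g :: "nat \<Rightarrow> 'a \<Rightarrow> real" where g: "\<And>n. continuous_map X (top_of_set {0..1}) (g n)"
      "\<And>n. g n (x n) = 0" "\<And>n. g n ` (X closure_of G n) \<subseteq> {1}"
    by metis
  define h where "h n y = real n * (1 - g n y)" for n y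
  have g_cont: "continuous_map X euclideanreal (g n)" for n
    using g(1) continuous_map_in_subtopology by blast
  have g_range: "0 \<le> g n y \<and> g n y \<le> 1" if "y \<in> topspace X" for n y
    using g(1)[of n] that by (auto simp: continuous_map_in_subtopology Pi_iff image_subset_iff)
  have h_cont: "continuous_map X euclideanreal (h n)" for n
    unfolding h_def using g_cont by (intro continuous_intros) auto
  have h_range: "0 \<le> h n y \<and> h n y \<le> real n" if "y \<in> topspace X" for n y
    using g_range[OF that, of n] by (auto simp: h_def mult_left_le)
  have h_zero: "h n y = 0" if "y \<in> G m" "m \<le> n" for m n y
    using g(3)[of n] G_mono[OF that(2)] that(1) closure_of_subset[OF openin_subset[OF G_open[of n]]]
    by (force simp: h_def)
  \<comment> \<open>\<open>F\<close> is the sum of all bumps, written as a finite sum by cutting off where the terms vanish.\<close>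
  define N where "N y = (LEAST n. y \<in> G n)" for y
  define F where "F y = (\<Sum>k<N y. h k y)" for y
  have F_eq: "F y = (\<Sum>k<n. h k y)" if "y \<in> G n" for n y
  proof -
    have "y \<in> G (N y)" "N y \<le> n"
      unfolding N_def using that by (auto intro: LeastI Least_le)
    then show ?thesis
      unfolding F_def using h_zero by (intro sum.mono_neutral_left) auto
  qed
  have "continuous_map X euclideanreal F"
    unfolding continuous_map_def
  proof (intro conjI allI impI)
    fix V :: "real set" assume V: "openin euclideanreal V"
    have "{y \<in> topspace X. F y \<in> V} = (\<Union>n. G n \<inter> {y \<in> topspace X. (\<Sum>k<n. h k y) \<in> V})"
      using G_cover F_eq by fastforce
    moreover have "openin X {y \<in> topspace X. (\<Sum>k<n. h k y) \<in> V}" for n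
      using V by (intro openin_continuous_map_preimage[of X euclideanreal] continuous_map_sum h_cont) auto
    ultimately show "openin X {y \<in> topspace X. F y \<in> V}"
      using G_open by (auto intro!: openin_Union openin_Int)
  qed simp
  moreover have "bounded (F ` G n)" for n
  proof -
    have "\<bar>F y\<bar> \<le> (\<Sum>k<n. real k)" if "y \<in> G n" for y
    proof -
      have "y \<in> topspace X"
        using that openin_subset[OF G_open[of n]] by blast
      then have "0 \<le> F y" "F y \<le> (\<Sum>k<n. real k)"
        using h_range[of y] unfolding F_eq[OF that] by (auto intro: sum_nonneg sum_mono)
      then show ?thesis
        by simp
    qed
    then show ?thesis
      unfolding bounded_iff by auto
  qed
  moreover have "\<not> bounded (F ` B)"
  proof
    assume "bounded (F ` B)"
    then obtain c where c: "\<And>y. y \<in> B \<Longrightarrow> \<bar>F y\<bar> \<le> c"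
      unfolding bounded_iff by auto
    obtain k where k: "c < real k"
      using reals_Archimedean2 by blast
    have xk: "x k \<in> topspace X"
      using x(1) B(1) by blast
    then obtain n where n: "x k \<in> G n"
      using G_cover by blast
    have "k < n"
      using G_mono[of n "Suc k"] n x(2)[of k] by force
    then have "h k (x k) \<le> F (x k)"
      unfolding F_eq[OF n] using h_range[OF xk] by (intro member_le_sum) auto
    then have "real k \<le> F (x k)"
      using g(2)[of k] by (simp add: h_def)
    then show False
      using c[OF x(1)[of k]] k by linarith
  qed
  ultimately show thesis
    using that by blast
qed

lemma initial_topology_completely_regular:
  fixes C :: "('a \<Rightarrow> real) set"
  assumes X: "completely_regular_space X"
    and cont: "\<And>f. f \<in> C \<Longrightarrow> continuous_map X euclideanreal f"
    and bdd: "\<And>f. continuous_map X (top_of_set {0..1}) f \<Longrightarrow> f \<in> C"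
  shows "X = initial_topology (topspace X) C (\<lambda>f. f) (\<lambda>_. euclideanreal)" (is "_ = ?I")
proof (rule topology_eq[THEN iffD2], intro allI iffI)
  fix W assume W: "openin X W"
  show "openin ?I W"
  proof (subst openin_subopen, intro ballI)
    fix x assume x: "x \<in> W"
    have "closedin X (topspace X - W)" "x \<in> topspace X - (topspace X - W)"
      using W x openin_subset[OF W] by auto
    then obtain f :: "'a \<Rightarrow> real" where f: "continuous_map X (top_of_set {0..1}) f" "f x = 0"
        "f ` (topspace X - W) \<subseteq> {1}"
      using X unfolding completely_regular_space_def by blast
    let ?T = "topspace X \<inter> f -` {..<1}"
    have "openin ?I ?T"
      using openin_initial_topology_preimage[of f C "\<lambda>_. euclideanreal" "{..<1}" _ "\<lambda>f. f"] bdd[OF f(1)]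
      by simp
    moreover have "x \<in> ?T" "?T \<subseteq> W"
      using f(2,3) x openin_subset[OF W] by auto
    ultimately show "\<exists>T. openin ?I T \<and> x \<in> T \<and> T \<subseteq> W"
      by blast
  qed
next
  fix W assume "openin ?I W"
  then show "openin X W"
  proof (rule openin_initial_topology_coarsest)
    show "openin X (topspace X \<inter> f -` V)" if "f \<in> C" "openin euclideanreal V" for f V
      using openin_continuous_map_preimage[OF cont[OF that(1)] that(2)]
      by (simp add: vimage_def Int_def)
  qed simp
qed

section \<open>The equivalences\<close>

lemma bb_uniformizable_if_C_initial_source:
  assumes \<B>: "bornology_on (topspace X) \<B>" and C: "C_initial_source X \<B>"
  shows "bb_uniformizable X \<B>"
proof -
  let ?C = "bornological_C X \<B>"
  have X: "X = initial_topology (topspace X) ?C (\<lambda>f. f) (\<lambda>_. euclideanreal)"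
    and B: "\<And>B. B \<subseteq> topspace X \<Longrightarrow> B \<in> \<B> \<longleftrightarrow> (\<forall>f\<in>?C. bounded (f ` B))"
    using C unfolding C_initial_source_def initial_source_def real_bornology_def by auto
  have "\<B> \<subseteq> Pow (topspace X)"
    using \<B> by (simp add: bornology_on_def)
  then have "B \<in> \<B> \<longleftrightarrow> B \<subseteq> topspace X \<and> (\<forall>f\<in>?C. bounded (f ` B))" for B
    using B[of B] by auto
  then have "\<B> = {B. bourbaki_bounded (topspace X) (function_uniformity (topspace X) ?C) B}"
    by (simp add: bourbaki_bounded_function_uniformity set_eq_iff)
  moreover have "uniform_topology (topspace X) (function_uniformity (topspace X) ?C) = X"
    using X uniform_topology_function_uniformity[of "topspace X" ?C] by simp
  ultimately show ?thesis
    unfolding bb_uniformizable_def using uniform_structure_function_uniformity by blast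
qed

lemma completely_regular_saturated_if_bb_uniformizable:
  assumes "bb_uniformizable X \<B>"
  shows "completely_regular_space X \<and> saturated_bornology X \<B>"
  using assms completely_regular_uniform_topology saturated_bourbaki_bounded
  unfolding bb_uniformizable_def by metis

text \<open>
  A set \<open>B\<close> on which all functions of \<open>bornological_C X \<B>\<close> are bounded cannot escape an exhaustion
  that absorbs \<open>\<B>\<close>: otherwise some continuous function would be bounded on every member of the
  exhaustion, hence belong to \<open>bornological_C X \<B>\<close>, and be unbounded on \<open>B\<close>.
\<close>

lemma C_initial_source_if_completely_regular_saturated:
  assumes \<B>: "bornology_on (topspace X) \<B>"
    and X: "completely_regular_space X" and sat: "saturated_bornology X \<B>"
  shows "C_initial_source X \<B>"
  unfolding C_initial_source_def initial_source_def
proof (intro conjI ballI allI impI)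
  let ?C = "bornological_C X \<B>"
  show "X = initial_topology (topspace X) ?C (\<lambda>f. f) (\<lambda>_. euclideanreal)"
  proof (rule initial_topology_completely_regular[OF X])
    fix f :: "'a \<Rightarrow> real" assume f: "continuous_map X (top_of_set {0..1}) f"
    have "bounded (f ` B)" if "B \<in> \<B>" for B
    proof (rule bounded_subset[of "{0..1}"])
      have "B \<subseteq> topspace X"
        using that \<B> by (auto simp: bornology_on_def)
      then show "f ` B \<subseteq> {0..1}"
        using f by (auto simp: continuous_map_in_subtopology Pi_iff image_subset_iff)
    qed simp
    then show "f \<in> ?C"
      using f by (auto simp: bornological_C_def real_bornology_def continuous_map_in_subtopology)
  qed (simp add: bornological_C_def)
  fix B assume BX: "B \<subseteq> topspace X"
  show "B \<in> \<B> \<longleftrightarrow> (\<forall>f\<in>?C. f ` B \<in> real_bornology)"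
  proof
    assume bdd: "\<forall>f\<in>?C. f ` B \<in> real_bornology"
    have "\<exists>m. B \<subseteq> G m"
      if G: "\<forall>n. openin X (G n)" "\<forall>A\<in>\<B>. \<exists>n. A \<subseteq> G n" "\<forall>n. X closure_of G n \<subseteq> G (Suc n)"
      for G :: "nat \<Rightarrow> 'a set"
    proof (rule ccontr)
      assume notin: "\<not> (\<exists>m. B \<subseteq> G m)"
      have "\<exists>n. y \<in> G n" if "y \<in> topspace X" for y
      proof -
        have "{y} \<in> \<B>"
          using \<B> that by (simp add: bornology_on_def)
        then show ?thesis
          using G(2) by (metis insert_subset)
      qed
      then have cover: "topspace X \<subseteq> (\<Union>n. G n)"
        by auto
      obtain F :: "'a \<Rightarrow> real" where F: "continuous_map X euclideanreal F"
          "\<And>n. bounded (F ` G n)" "\<not> bounded (F ` B)"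
      proof (rule unbounded_function_on_exhaustion[OF X _ _ cover BX])
        show "openin X (G n)" "X closure_of G n \<subseteq> G (Suc n)" "\<not> B \<subseteq> G n" for n
          using G(1,3) notin by simp_all
      qed (rule that)
      have "bounded (F ` A)" if "A \<in> \<B>" for A
      proof -
        obtain n where "A \<subseteq> G n"
          using G(2) \<open>A \<in> \<B>\<close> by blast
        then show ?thesis
          using bounded_subset[OF F(2)[of n]] by blast
      qed
      then have "F \<in> ?C"
        using F(1) by (simp add: bornological_C_def real_bornology_def)
      then show False
        using bdd F(3) by (simp add: real_bornology_def)
    qed
    then show "B \<in> \<B>"
      using sat BX unfolding saturated_bornology_def by blast
  qed (simp add: bornological_C_def)
qed (auto simp: bornological_C_def)

theorem proposition9:
  fixes X :: "'a topology" and \<B> :: "'a set set"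
  assumes "bornology_on (topspace X) \<B>"
  shows "(C_initial_source X \<B> \<longleftrightarrow> bb_uniformizable X \<B>) \<and>
         (bb_uniformizable X \<B> \<longleftrightarrow> completely_regular_space X \<and> saturated_bornology X \<B>)"
  using bb_uniformizable_if_C_initial_source[OF assms]
    completely_regular_saturated_if_bb_uniformizable
    C_initial_source_if_completely_regular_saturated[OF assms]
  by blast

end
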